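(* If $P$ is a poset that is not reversible, then $P$ contains a subset which (with the induced order) is isomorphic to $F_i$ or to its dual $F_i^d$ for some $i\in\{1,\ldots,8\}$.
   Context: A poset $P$ is called reversible if every order preserving bijective self map $P\to P$ is an order automorphism (i.e. its inverse is also order preserving). Notation: $P^d$ is the dual poset of $P$; $P\sqcup Q$ is the disjoint union (no comparabilities between $P$ and $Q$); $P\oplus Q$ is the linear sum (disjoint union in which additionally every element of $P$ is below every element of $Q$). $\omega$ is the least infinite ordinal (as a chain), $D_\infty$ is the antichain of cardinality $\aleph_0$, $D_1$ is the one-element poset. The posets $F_1,\ldots,F_8$ are: - $F_1=D_\infty\sqcup\omega$; - $F_2=(D_1\oplus D_\infty)\sqcup D_\infty$; - $F_3=D_\infty\sqcup\bigsqcup_{i=0}^{\infty}(D_1\oplus D_1)$; - $F_4=D_\infty\oplus\omega$; - $F_5=(D_1\sqcup\omega^d)\oplus\omega$; - $F_6=E\oplus\omega$, where $E=\{a_i\}_{i\in\mathbb{N}}\cup\{b_i\}_{i\in\mathbb{N}}$ (all these elements distinct) is ordered so that $a_i$ and $b_i$ are incomparable for every $i$, and both $a_j$ and $b_j$ are strictly below both $a_i$ and $b_i$ whenever $j>i$ (a descending $\omega^d$-indexed linear sum of two-element antichains); - $F_7=\{c_0,c_1,c_2,\ldots\}\cup\{d_1,d_2,\ldots\}$ (all elements distinct), where $c_0<c_1<c_2<\cdots$, the $d_i$ form an antichain, no $c_j$ is below any $d_i$, and $d_i<c_j$ if and only if $i\le j$; - $F_8=\{a_i\}_{i\in\mathbb{Z}}\cup\{b_i\}_{i\in\mathbb{Z}}$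 (all elements distinct), whose only strict relations are $a_i<b_j$ for those $i,j\in\mathbb{Z}$ with $i>0$ or $j\ne i$. *)

theory Defs
  imports Main
begin

text \<open>A poset with carrier \<open>A\<close> is given by a reflexive order relation \<open>r\<close> with
  \<^term>\<open>partial_order_on A r\<close>. Reflexivity gives \<^term>\<open>Field r = A\<close>, so for the concrete posets
  below only the relation is defined, and the dual of \<open>r\<close> is \<^term>\<open>r\<inverse>\<close>.\<close>

definition order_preserving :: "'a set \<Rightarrow> 'a rel \<Rightarrow> 'b set \<Rightarrow> 'b rel \<Rightarrow> ('a \<Rightarrow> 'b) \<Rightarrow> bool" where
  "order_preserving A r B s f \<longleftrightarrow>
     f ` A \<subseteq> B \<and> monotone_on A (\<lambda>x y. (x, y) \<in> r) (\<lambda>x y. (x, y) \<in> s) f"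

definition order_isomorphism :: "'a set \<Rightarrow> 'a rel \<Rightarrow> 'b set \<Rightarrow> 'b rel \<Rightarrow> ('a \<Rightarrow> 'b) \<Rightarrow> bool" where
  "order_isomorphism A r B s f \<longleftrightarrow>
     bij_betw f A B \<and> order_preserving A r B s f \<and> order_preserving B s A r (the_inv_into A f)"

definition isomorphic_posets :: "'a set \<Rightarrow> 'a rel \<Rightarrow> 'b set \<Rightarrow> 'b rel \<Rightarrow> bool" where
  "isomorphic_posets A r B s \<longleftrightarrow> (\<exists>f. order_isomorphism A r B s f)"

definition reversible :: "'a set \<Rightarrow> 'a rel \<Rightarrow> bool" where
  "reversible A r \<longleftrightarrow>
     (\<forall>f. bij_betw f A A \<and> order_preserving A r A r f \<longrightarrow> order_isomorphism A r A r f)"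

definition contains_copy :: "'a set \<Rightarrow> 'a rel \<Rightarrow> 'b rel \<Rightarrow> bool" where
  "contains_copy A r s \<longleftrightarrow> (\<exists>B\<subseteq>A. isomorphic_posets B (Restr r B) (Field s) s)"

definition disjoint_sum :: "'a rel \<Rightarrow> 'b rel \<Rightarrow> ('a + 'b) rel" (infixr "\<squnion>\<^sub>P" 65) where
  "r \<squnion>\<^sub>P s = {(Inl x, Inl y) | x y. (x, y) \<in> r} \<union> {(Inr x, Inr y) | x y. (x, y) \<in> s}"

definition linear_sum :: "'a rel \<Rightarrow> 'b rel \<Rightarrow> ('a + 'b) rel" (infixr "\<oplus>\<^sub>P" 65) where
  "r \<oplus>\<^sub>P s = (r \<squnion>\<^sub>P s) \<union> {(Inl x, Inr y) | x y. x \<in> Field r \<and> y \<in> Field s}"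

definition disjoint_Sum :: "('i \<Rightarrow> 'a rel) \<Rightarrow> ('i \<times> 'a) rel" where
  "disjoint_Sum r = {((i, x), (i, y)) | i x y. (x, y) \<in> r i}"

definition omega :: "nat rel" where
  "omega = {(m, n). m \<le> n}"

definition D_inf :: "nat rel" where
  "D_inf = Id"

definition D_one :: "unit rel" where
  "D_one = Id"

definition F1 :: "(nat + nat) rel" where
  "F1 = D_inf \<squnion>\<^sub>P omega"

definition F2 :: "((unit + nat) + nat) rel" where
  "F2 = (D_one \<oplus>\<^sub>P D_inf) \<squnion>\<^sub>P D_inf"

definition F3 :: "(nat + (nat \<times> (unit + unit))) rel" where
  "F3 = D_inf \<squnion>\<^sub>P disjoint_Sum (\<lambda>i::nat. D_one \<oplus>\<^sub>P D_one)"

definition F4 :: "(nat + nat) rel" where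
  "F4 = D_inf \<oplus>\<^sub>P omega"

definition F5 :: "((unit + nat) + nat) rel" where
  "F5 = (D_one \<squnion>\<^sub>P omega\<inverse>) \<oplus>\<^sub>P omega"

text \<open>In \<open>E_ladder\<close> and \<open>F8\<close>, \<open>Inl i\<close> is $a_i$ and \<open>Inr i\<close> is $b_i$.
  In \<open>F7\<close>, \<open>Inl j\<close> is $c_j$ and \<open>Inr i\<close> is $d_i$; \<open>Inr 0\<close> is not in the field.\<close>

definition E_ladder :: "(nat + nat) rel" where
  "E_ladder = Id \<union>
     {(x, y) | x y i j. i < j \<and> x \<in> {Inl j, Inr j} \<and> y \<in> {Inl i, Inr i}}"

definition F6 :: "((nat + nat) + nat) rel" where
  "F6 = E_ladder \<oplus>\<^sub>P omega"

definition F7 :: "(nat + nat) rel" where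
  "F7 = {(Inl i, Inl j) | i j. i \<le> j} \<union> {(Inr i, Inr i) | i. 1 \<le> i}
     \<union> {(Inr i, Inl j) | i j. 1 \<le> i \<and> i \<le> j}"

definition F8 :: "(int + int) rel" where
  "F8 = Id \<union> {(Inl i, Inr j) | i j. i > 0 \<or> j \<noteq> i}"

end

theory Submission
  imports Defs "HOL-Library.Ramsey"
begin

text \<open>
  If \<open>P\<close> is not reversible, some order preserving bijection \<open>f\<close> and some \<open>a\<close>, \<open>b\<close> satisfy
  \<open>f a \<le> f b\<close> but not \<open>a \<le> b\<close>. Consider the two-sided orbits \<open>x n = f\<^sup>n a\<close> and
  \<open>y n = f\<^sup>n b\<close> for integers \<open>n\<close>. Moving forward along the orbits can only create
  relations, never destroy them (\<open>shift_closed\<close>); hence \<open>x n \<le> y n\<close> holds for \<open>n \<ge> 1\<close> and fails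
  for \<open>n \<le> 0\<close>. The obstruction is always found inside the two orbits: the far past and the far
  future look different, and Ramsey's theorem makes both of them homogeneous. Everything is
  stable under replacing \<open>f\<close> by a positive power, which amounts to reindexing the orbits by
  multiples, and under passing to the dual poset, which exchanges \<open>x\<close> and \<open>y\<close>.

  The recurring tool is \<open>antichain_vs_omega\<close>: an infinite antichain and an ascending \<open>\<omega>\<close>-chain,
  with no chain element below an antichain element, already contain \<open>F1\<close>, \<open>F4\<close> or \<open>F7\<close>. There
  are three situations; both orbits cannot be finite, since the relation between \<open>x n\<close> and \<open>y n\<close>
  would then be periodic in \<open>n\<close>.

  \<^item> One orbit is finite. After passing to a power it is a fixed point \<open>u\<close>, which up to duality lies
    below the future of \<open>y\<close> but not below its past. Depending on whether \<open>y\<close> has a descending,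
    an ascending or no comparability, one finds the dual of \<open>F1\<close>; \<open>F5\<close> or
    \<open>antichain_vs_omega\<close>; or \<open>F2\<close> (\<open>fixed_point_case\<close>).

  \<^item> A relation is gained within one infinite orbit \<open>z\<close>, in particular when \<open>a\<close> and \<open>b\<close> share an
    orbit. After passing to a power and possibly dualising, \<open>z n\<close> and \<open>z (n + 1)\<close> are incomparable
    in the past and ascend in the future. If the past contains an infinite antichain,
    \<open>antichain_vs_omega\<close> applies; otherwise it contains a descending chain, and either some \<open>z n\<close> lies
    above none of its members (\<open>F5\<close>) or the pairs \<open>z n\<close>, \<open>z (n + 1)\<close> can be stacked to the ladder
    \<open>F6\<close> (\<open>orbit_step_case\<close>, \<open>orbit_relation_gained\<close>).

  \<^item> The orbits are infinite and different, and none gains a relation internally. Then after passing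
    to a power each of them is an antichain, an ascending or a descending integer chain
    (\<open>rigid_orbit_uniform\<close>). Up to duality, an antichain and a chain fall to \<open>antichain_vs_omega\<close>, two
    chains give \<open>F5\<close> or \<open>F6\<close>, and two antichains form a bipartite poset. In the latter, a vertex
    with infinitely many neighbours and infinitely many non-neighbours on the other side gives \<open>F2\<close>
    or its dual; if there is none, then either all
    neighbourhoods are finite, giving \<open>F3\<close>, or all are cofinite, giving \<open>F8\<close>
    (\<open>both_antichains\<close>).
\<close>

section \<open>Subsequences, antichains and chains\<close>

lemma homogeneous_subsequence:
  fixes Q :: "nat \<Rightarrow> nat \<Rightarrow> bool"
  obtains \<phi> :: "nat \<Rightarrow> nat" where "strict_mono \<phi>" "\<forall>i j. i < j \<longrightarrow> Q (\<phi> i) (\<phi> j)"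
  | \<phi> :: "nat \<Rightarrow> nat" where "strict_mono \<phi>" "\<forall>i j. i < j \<longrightarrow> \<not> Q (\<phi> i) (\<phi> j)"
proof -
  let ?f = "\<lambda>X. if Q (Min X) (Max X) then 0 else 1 :: nat"
  have "\<exists>Y t. Y \<subseteq> (UNIV :: nat set) \<and> infinite Y \<and> t < 2 \<and>
      (\<forall>x\<in>Y. \<forall>y\<in>Y. x \<noteq> y \<longrightarrow> ?f {x, y} = t)"
    by (rule Ramsey2) auto
  then obtain Y t where Y: "infinite Y" "\<forall>x\<in>Y. \<forall>y\<in>Y. x \<noteq> y \<longrightarrow> ?f {x, y} = t"
    by blast
  let ?\<phi> = "enumerate Y"
  have mono: "strict_mono ?\<phi>"
    using Y(1) by (rule strict_mono_enumerate)
  have col: "?f {?\<phi> i, ?\<phi> j} = t" if "i < j" for i j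
    using that Y enumerate_in_set[OF Y(1)] strict_monoD[OF mono that] by (metis less_irrefl)
  have MinMax: "Min {?\<phi> i, ?\<phi> j} = ?\<phi> i" "Max {?\<phi> i, ?\<phi> j} = ?\<phi> j" if "i < j" for i j
    using strict_monoD[OF mono that] by auto
  show thesis
  proof (cases "t = 0")
    case True
    with col MinMax have "\<forall>i j. i < j \<longrightarrow> Q (?\<phi> i) (?\<phi> j)"
      by (metis zero_neq_one)
    with mono show thesis by (rule that(1))
  next
    case False
    with col MinMax have "\<forall>i j. i < j \<longrightarrow> \<not> Q (?\<phi> i) (?\<phi> j)"
      by metis
    with mono show thesis by (rule that(2))
  qed
qed

text \<open>This replaces greedy choices: a homogeneous subsequence cannot take the negative colour, because
  its first index is good with all sufficiently late ones.\<close>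

lemma eventually_homogeneous_subsequence:
  fixes Q :: "nat \<Rightarrow> nat \<Rightarrow> bool"
  assumes "\<And>m. \<exists>N. \<forall>n\<ge>N. Q m n"
  obtains \<phi> :: "nat \<Rightarrow> nat" where "strict_mono \<phi>" "\<forall>i j. i < j \<longrightarrow> Q (\<phi> i) (\<phi> j)"
proof (rule homogeneous_subsequence[of Q])
  fix \<phi> :: "nat \<Rightarrow> nat"
  assume \<phi>: "strict_mono \<phi>" "\<forall>i j. i < j \<longrightarrow> \<not> Q (\<phi> i) (\<phi> j)"
  obtain N where "\<forall>n\<ge>N. Q (\<phi> 0) n"
    using assms by blast
  then have "Q (\<phi> 0) (\<phi> (Suc N))"
    using strict_mono_imp_increasing[OF \<phi>(1), of "Suc N"] by simp
  with \<phi>(2) show thesis by blast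
qed (use that in blast)

lemma constant_subsequence:
  fixes P :: "nat \<Rightarrow> bool"
  obtains \<phi> :: "nat \<Rightarrow> nat" where "strict_mono \<phi>" "\<forall>i. P (\<phi> i)"
  | \<phi> :: "nat \<Rightarrow> nat" where "strict_mono \<phi>" "\<forall>i. \<not> P (\<phi> i)"
  by (rule homogeneous_subsequence[of "\<lambda>i _. P i"]) (use that lessI in metis)+

lemma finite_avoided_eventually:
  fixes g :: "nat \<Rightarrow> 'a"
  assumes "finite S" "inj g"
  shows "\<exists>N. \<forall>n\<ge>N. g n \<notin> S"
proof -
  have "finite (g -` S)"
    using assms by (rule finite_vimageI)
  then obtain N where "\<forall>n\<in>g -` S. n < N"
    using finite_nat_set_iff_bounded by blast
  then show ?thesis
    by (metis not_less vimageI)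
qed

text \<open>The equivalences include reflexivity, so these predicates place the sequence inside the carrier
  and make it injective. A descending chain of \<open>r\<close> is an ascending chain of \<open>r\<inverse>\<close>.\<close>

definition antichain_seq :: "'a rel \<Rightarrow> ('i \<Rightarrow> 'a) \<Rightarrow> bool" where
  "antichain_seq r d \<longleftrightarrow> (\<forall>i j. (d i, d j) \<in> r \<longleftrightarrow> i = j)"

definition ascending :: "'a rel \<Rightarrow> ('i :: linorder \<Rightarrow> 'a) \<Rightarrow> bool" where
  "ascending r c \<longleftrightarrow> (\<forall>i j. (c i, c j) \<in> r \<longleftrightarrow> i \<le> j)"

lemma antichain_seqD: "antichain_seq r d \<Longrightarrow> (d i, d j) \<in> r \<longleftrightarrow> i = j"
  by (simp add: antichain_seq_def)

lemma ascendingD: "ascending r c \<Longrightarrow> (c i, c j) \<in> r \<longleftrightarrow> i \<le> j"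
  by (simp add: ascending_def)

lemma antichain_seq_converse [simp]: "antichain_seq (r\<inverse>) d \<longleftrightarrow> antichain_seq r d"
  by (auto simp: antichain_seq_def)

lemma antichain_seq_comp: "antichain_seq r d \<Longrightarrow> inj h \<Longrightarrow> antichain_seq r (\<lambda>i. d (h i))"
  by (simp add: antichain_seq_def inj_eq)

lemma ascending_comp: "ascending r c \<Longrightarrow> strict_mono h \<Longrightarrow> ascending r (\<lambda>i. c (h i))"
  by (simp add: ascending_def strict_mono_less_eq)

lemma strict_mono_add_nat: "strict_mono (\<lambda>k. n + k :: nat)"
  by (simp add: strict_mono_def)

section \<open>The forbidden subposets\<close>

definition has_obstruction :: "'a set \<Rightarrow> 'a rel \<Rightarrow> bool" where
  "has_obstruction A r \<longleftrightarrow>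
    contains_copy A r F1 \<or> contains_copy A r (F1\<inverse>) \<or>
    contains_copy A r F2 \<or> contains_copy A r (F2\<inverse>) \<or>
    contains_copy A r F3 \<or> contains_copy A r (F3\<inverse>) \<or>
    contains_copy A r F4 \<or> contains_copy A r (F4\<inverse>) \<or>
    contains_copy A r F5 \<or> contains_copy A r (F5\<inverse>) \<or>
    contains_copy A r F6 \<or> contains_copy A r (F6\<inverse>) \<or>
    contains_copy A r F7 \<or> contains_copy A r (F7\<inverse>) \<or>
    contains_copy A r F8 \<or> contains_copy A r (F8\<inverse>)"

lemma contains_copy_converse:
  "contains_copy A (r\<inverse>) s \<longleftrightarrow> contains_copy A r (s\<inverse>)"
proof -
  have op: "order_preserving B (s\<inverse>) C (t\<inverse>) f \<longleftrightarrow> order_preserving B s C t f"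
    for B C and s :: "'c rel" and t :: "'d rel" and f
    by (auto simp: order_preserving_def monotone_on_def)
  have iso: "isomorphic_posets B (s\<inverse>) C (t\<inverse>) \<longleftrightarrow> isomorphic_posets B s C t"
    for B C and s :: "'c rel" and t :: "'d rel"
    by (simp add: isomorphic_posets_def order_isomorphism_def op)
  have restr: "Restr (r\<inverse>) B = (Restr r B)\<inverse>" for B
    by auto
  have "isomorphic_posets B (Restr (r\<inverse>) B) (Field s) s \<longleftrightarrow>
      isomorphic_posets B (Restr r B) (Field (s\<inverse>)) (s\<inverse>)" for B
    using iso[of B "Restr r B" "Field s" "s\<inverse>"]
    unfolding restr Field_converse converse_converse .
  then show ?thesis
    unfolding contains_copy_def by simp
qed

lemma has_obstruction_converse [simp]: "has_obstruction A (r\<inverse>) \<longleftrightarrow> has_obstruction A r"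
  unfolding has_obstruction_def contains_copy_converse converse_converse by blast

locale poset =
  fixes A :: "'a set" and r :: "'a rel"
  assumes po: "partial_order_on A r"
begin

abbreviation le (infix "\<preceq>" 50) where
  "x \<preceq> y \<equiv> (x, y) \<in> r"

lemma le_refl: "x \<in> A \<Longrightarrow> x \<preceq> x"
  using partial_order_onD(1)[OF po] by (rule refl_onD)

lemma le_trans: "x \<preceq> y \<Longrightarrow> y \<preceq> z \<Longrightarrow> x \<preceq> z"
  using partial_order_onD(2)[OF po] by (rule transD)

lemma le_antisym: "x \<preceq> y \<Longrightarrow> y \<preceq> x \<Longrightarrow> x = y"
  using partial_order_onD(3)[OF po] by (rule antisymD)

lemma le_carrier: "x \<preceq> y \<Longrightarrow> x \<in> A" "x \<preceq> y \<Longrightarrow> y \<in> A"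
  using partial_order_onD(4)[OF po] by auto

lemma le_reflL: "x \<preceq> y \<Longrightarrow> x \<preceq> x" and le_reflR: "x \<preceq> y \<Longrightarrow> y \<preceq> y"
  using le_carrier le_refl by auto

lemma dual: "poset A (r\<inverse>)"
  using po by unfold_locales simp

text \<open>Order reflection makes \<open>e\<close> injective, since \<open>s\<close> is antisymmetric, and the reflexive pairs of
  \<open>s\<close> force the values of \<open>e\<close> into the carrier.\<close>

lemma contains_copyI:
  assumes "refl_on (Field s) s" and "antisym s"
    and e: "\<And>x y. x \<in> Field s \<Longrightarrow> y \<in> Field s \<Longrightarrow> e x \<preceq> e y \<longleftrightarrow> (x, y) \<in> s"
  shows "contains_copy A r s"
proof -
  let ?F = "Field s" and ?B = "e ` Field s"
  have refl: "e x \<preceq> e x" if "x \<in> ?F" for x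
    using e[OF that that] assms(1) that by (auto dest: refl_onD)
  have inj: "inj_on e ?F"
  proof (rule inj_onI)
    fix x y assume xy: "x \<in> ?F" "y \<in> ?F" "e x = e y"
    with e[of x y] e[of y x] refl have "(x, y) \<in> s" "(y, x) \<in> s"
      by metis+
    with \<open>antisym s\<close> show "x = y" by (rule antisymD)
  qed
  let ?g = "the_inv_into ?F e"
  have ge: "?g (e x) = x" if "x \<in> ?F" for x
    using inj that by (rule the_inv_into_f_f)
  have g: "bij_betw ?g ?B ?F"
    using inj by (simp add: bij_betw_the_inv_into inj_on_imp_bij_betw)
  have inv_g: "the_inv_into ?B ?g x = e x" if "x \<in> ?F" for x
    using the_inv_into_f_f[OF bij_betw_imp_inj_on[OF g], of "e x"] that ge by simp
  have "order_isomorphism ?B (Restr r ?B) ?F s ?g"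
    unfolding order_isomorphism_def order_preserving_def monotone_on_def
    using g e ge inv_g by auto
  moreover have "?B \<subseteq> A"
    using refl le_carrier by blast
  ultimately show ?thesis
    unfolding contains_copy_def isomorphic_posets_def by blast
qed

lemma F1_I:
  assumes d: "antichain_seq r (d :: nat \<Rightarrow> 'a)" and c: "ascending r (c :: nat \<Rightarrow> 'a)"
    and dc: "\<And>i j. \<not> d i \<preceq> c j" "\<And>i j. \<not> c i \<preceq> d j"
  shows "has_obstruction A r"
proof -
  have F: "F1 = {(Inl i, Inl i) | i. True} \<union> {(Inr i, Inr j) | i j. i \<le> j}"
    by (auto simp: F1_def D_inf_def omega_def disjoint_sum_def)
  have "contains_copy A r F1"
  proof (rule contains_copyI)
    show "refl_on (Field F1) F1" "antisym F1"
      by (auto simp: F refl_on_def Field_def antisym_def)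
    show "case_sum d c x \<preceq> case_sum d c y \<longleftrightarrow> (x, y) \<in> F1" for x y
      using dc by (cases x; cases y) (auto simp: F antichain_seqD[OF d] ascendingD[OF c])
  qed
  then show ?thesis by (simp add: has_obstruction_def)
qed

lemma F2_I:
  assumes a: "antichain_seq r (a :: nat \<Rightarrow> 'a)" and b: "antichain_seq r (b :: nat \<Rightarrow> 'a)"
    and u: "\<And>i. u \<preceq> a i" "\<And>i. \<not> a i \<preceq> u" "\<And>i. \<not> u \<preceq> b i" "\<And>i. \<not> b i \<preceq> u"
    and ab: "\<And>i j. \<not> a i \<preceq> b j" "\<And>i j. \<not> b i \<preceq> a j"
  shows "has_obstruction A r"
proof -
  have F: "F2 = {(Inl (Inl ()), Inl (Inl ()))} \<union> {(Inl (Inl ()), Inl (Inr i)) | i. True}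
      \<union> {(Inl (Inr i), Inl (Inr i)) | i. True} \<union> {(Inr i, Inr i) | i. True}"
    by (auto simp: F2_def D_one_def D_inf_def linear_sum_def disjoint_sum_def Field_def)
  let ?e = "case_sum (case_sum (\<lambda>_. u) a) b"
  have "contains_copy A r F2"
  proof (rule contains_copyI)
    show "refl_on (Field F2) F2" "antisym F2"
      by (auto simp: F refl_on_def Field_def antisym_def)
    show "?e x \<preceq> ?e y \<longleftrightarrow> (x, y) \<in> F2" for x y
      using u ab le_reflL[OF u(1)]
      by (auto simp: F antichain_seqD[OF a] antichain_seqD[OF b] split: sum.splits)
  qed
  then show ?thesis by (simp add: has_obstruction_def)
qed

lemma F3_I:
  assumes d: "antichain_seq r (d :: nat \<Rightarrow> 'a)"
    and a: "antichain_seq r (a :: nat \<Rightarrow> 'a)" and b: "antichain_seq r (b :: nat \<Rightarrow> 'a)"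
    and da: "\<And>i j. \<not> d i \<preceq> a j" "\<And>i j. \<not> a i \<preceq> d j"
    and db: "\<And>i j. \<not> d i \<preceq> b j" "\<And>i j. \<not> b i \<preceq> d j"
    and ab: "\<And>i j. a i \<preceq> b j \<longleftrightarrow> i = j" "\<And>i j. \<not> b i \<preceq> a j"
  shows "has_obstruction A r"
proof -
  have F: "F3 = {(Inl i, Inl i) | i. True} \<union> {(Inr (i, x), Inr (i, x)) | i x. True}
      \<union> {(Inr (i, Inl ()), Inr (i, Inr ())) | i. True}"
    by (auto simp: F3_def D_one_def D_inf_def linear_sum_def disjoint_sum_def disjoint_Sum_def
        Field_def)
       (metis (full_types) old.sum.exhaust old.unit.exhaust)
  let ?e = "case_sum d (\<lambda>(i, x). case x of Inl _ \<Rightarrow> a i | Inr _ \<Rightarrow> b i)"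
  have "contains_copy A r F3"
  proof (rule contains_copyI)
    show "refl_on (Field F3) F3" "antisym F3"
      by (auto simp: F refl_on_def Field_def antisym_def)
    show "?e x \<preceq> ?e y \<longleftrightarrow> (x, y) \<in> F3" for x y
      using da db ab
      by (auto simp: F antichain_seqD[OF a] antichain_seqD[OF b] antichain_seqD[OF d]
          split: sum.splits)
  qed
  then show ?thesis by (simp add: has_obstruction_def)
qed

lemma F4_I:
  assumes d: "antichain_seq r (d :: nat \<Rightarrow> 'a)" and c: "ascending r (c :: nat \<Rightarrow> 'a)"
    and dc: "\<And>i j. d i \<preceq> c j" "\<And>i j. \<not> c i \<preceq> d j"
  shows "has_obstruction A r"
proof -
  have F: "F4 = {(Inl i, Inl i) | i. True} \<union> {(Inr i, Inr j) | i j. i \<le> j}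
      \<union> {(Inl i, Inr j) | i j. True}"
    by (auto simp: F4_def D_inf_def omega_def linear_sum_def disjoint_sum_def Field_def)
  have "contains_copy A r F4"
  proof (rule contains_copyI)
    show "refl_on (Field F4) F4" "antisym F4"
      by (auto simp: F refl_on_def Field_def antisym_def)
    show "case_sum d c x \<preceq> case_sum d c y \<longleftrightarrow> (x, y) \<in> F4" for x y
      using dc by (cases x; cases y) (auto simp: F antichain_seqD[OF d] ascendingD[OF c])
  qed
  then show ?thesis by (simp add: has_obstruction_def)
qed

text \<open>The relations to \<open>c 0\<close> determine all others: a relation from \<open>c\<close> back to \<open>u\<close> or to \<open>a\<close>
  would make \<open>u\<close> and some \<open>a i\<close> comparable.\<close>

lemma F5_I:
  assumes a: "ascending (r\<inverse>) (a :: nat \<Rightarrow> 'a)" and c: "ascending r (c :: nat \<Rightarrow> 'a)"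
    and ua: "\<And>i. \<not> u \<preceq> a i" "\<And>i. \<not> a i \<preceq> u"
    and low: "u \<preceq> c 0" "a 0 \<preceq> c 0"
  shows "has_obstruction A r"
proof -
  have "x \<in> Field (D_one \<squnion>\<^sub>P omega\<inverse>)" for x
    by (cases x) (force simp: Field_def Domain_unfold disjoint_sum_def D_one_def omega_def)+
  then have D: "Field (D_one \<squnion>\<^sub>P omega\<inverse>) = UNIV" "Field omega = UNIV"
    by (auto simp: Field_def omega_def)
  have F: "F5 = {(Inl (Inl ()), Inl (Inl ()))} \<union> {(Inl (Inr i), Inl (Inr j)) | i j. j \<le> i}
      \<union> {(Inr i, Inr j) | i j. i \<le> j} \<union> {(Inl (Inl ()), Inr j) | j. True}
      \<union> {(Inl (Inr i), Inr j) | i j. True}"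
    unfolding F5_def linear_sum_def D
    by (auto simp: D_one_def omega_def disjoint_sum_def)
       (metis (full_types) old.sum.exhaust old.unit.exhaust)+
  have a': "a i \<preceq> a j \<longleftrightarrow> j \<le> i" for i j
    using ascendingD[OF a, of j i] by simp
  have uc: "u \<preceq> c j" and ac: "a i \<preceq> c j" for i j
    using low a' ascendingD[OF c] le_trans by (meson zero_le)+
  have cu: "\<not> c j \<preceq> u" and ca: "\<not> c j \<preceq> a i" for i j
    using uc ac ua le_trans by meson+
  let ?e = "case_sum (case_sum (\<lambda>_. u) a) c"
  have "contains_copy A r F5"
  proof (rule contains_copyI)
    show "refl_on (Field F5) F5" "antisym F5"
      by (auto simp: F refl_on_def Field_def antisym_def)
    show "?e x \<preceq> ?e y \<longleftrightarrow> (x, y) \<in> F5" for x y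
      using ua uc ac cu ca le_reflL[OF uc]
      by (auto simp: F a' ascendingD[OF c] split: sum.splits)
  qed
  then show ?thesis by (simp add: has_obstruction_def)
qed

text \<open>The downward relations determine the order completely: an upward one between different levels
  would, composed with them, relate \<open>a i\<close> and \<open>b i\<close> on a single level.\<close>

lemma F6_I:
  assumes c: "ascending r (c :: nat \<Rightarrow> 'a)"
    and ab: "\<And>i :: nat. \<not> a i \<preceq> b i" "\<And>i :: nat. \<not> b i \<preceq> a i"
    and down: "\<And>i j. i < j \<Longrightarrow> a j \<preceq> a i \<and> a j \<preceq> b i \<and> b j \<preceq> a i \<and> b j \<preceq> b i"
    and low: "a 0 \<preceq> c 0" "b 0 \<preceq> c 0"
  shows "has_obstruction A r"
proof -
  have F: "F6 = {(Inl x, Inl x) | x. True} \<union> {(Inl (Inl i), Inl (Inl j)) | i j. j < i}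
      \<union> {(Inl (Inl i), Inl (Inr j)) | i j. j < i} \<union> {(Inl (Inr i), Inl (Inl j)) | i j. j < i}
      \<union> {(Inl (Inr i), Inl (Inr j)) | i j. j < i}
      \<union> {(Inr i, Inr j) | i j. i \<le> j} \<union> {(Inl x, Inr j) | x j. True}"
    by (auto simp: F6_def E_ladder_def omega_def linear_sum_def disjoint_sum_def Field_def)
  have refl: "a i \<preceq> a i" "b i \<preceq> b i" for i
    using down[of i "Suc i"] le_reflR by blast+
  have up: "\<not> a i \<preceq> a j" "\<not> a i \<preceq> b j" "\<not> b i \<preceq> a j" "\<not> b i \<preceq> b j" if "i < j" for i j
    using down[OF that] ab le_trans by meson+
  have aa: "a i \<preceq> a j \<longleftrightarrow> j \<le> i" and bb: "b i \<preceq> b j \<longleftrightarrow> j \<le> i"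
    and abs: "a i \<preceq> b j \<longleftrightarrow> j < i" and bas: "b i \<preceq> a j \<longleftrightarrow> j < i" for i j
    using up[of i j] down[of j i] refl[of i] ab[of i]
    by (metis linorder_less_linear order_le_less)+
  have ac: "a i \<preceq> c j" and bc: "b i \<preceq> c j" for i j
    using low aa[of i 0] bb[of i 0] ascendingD[OF c, of 0 j] le_trans by (meson zero_le)+
  have ca: "\<not> c j \<preceq> a i" and cb: "\<not> c j \<preceq> b i" for i j
    using ac bc ab le_trans by meson+
  let ?e = "case_sum (case_sum a b) c"
  have "contains_copy A r F6"
  proof (rule contains_copyI)
    show "refl_on (Field F6) F6"
      by (auto simp: F refl_on_def Field_def)
    show "antisym F6"
      by (auto simp: F antisym_def)
    show "?e x \<preceq> ?e y \<longleftrightarrow> (x, y) \<in> F6" for x y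
      by (auto simp: F ascendingD[OF c] aa bb abs bas ac bc ca cb split: sum.splits)
  qed
  then show ?thesis by (simp add: has_obstruction_def)
qed

lemma F7_I:
  assumes d: "antichain_seq r (d :: nat \<Rightarrow> 'a)" and c: "ascending r (c :: nat \<Rightarrow> 'a)"
    and dc: "\<And>i j. d i \<preceq> c j \<longleftrightarrow> i \<le> j" "\<And>i j. \<not> c i \<preceq> d j"
  shows "has_obstruction A r"
proof -
  have "contains_copy A r F7"
  proof (rule contains_copyI)
    show "refl_on (Field F7) F7" "antisym F7"
      by (auto simp: F7_def refl_on_def Field_def antisym_def)
    show "case_sum c d x \<preceq> case_sum c d y \<longleftrightarrow> (x, y) \<in> F7"
      if "x \<in> Field F7" "y \<in> Field F7" for x y
      using that by (cases x; cases y)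
        (auto simp: F7_def Field_def antichain_seqD[OF d] ascendingD[OF c] dc)
  qed
  then show ?thesis by (simp add: has_obstruction_def)
qed

lemma F8_I:
  assumes a: "antichain_seq r (a :: int \<Rightarrow> 'a)" and b: "antichain_seq r (b :: int \<Rightarrow> 'a)"
    and ab: "\<And>i j. a i \<preceq> b j \<longleftrightarrow> i > 0 \<or> j \<noteq> i" "\<And>i j. \<not> b i \<preceq> a j"
  shows "has_obstruction A r"
proof -
  have "contains_copy A r F8"
  proof (rule contains_copyI)
    show "refl_on (Field F8) F8" "antisym F8"
      by (auto simp: F8_def refl_on_def Field_def antisym_def)
    show "case_sum a b x \<preceq> case_sum a b y \<longleftrightarrow> (x, y) \<in> F8" for x y
      by (cases x; cases y)
        (auto simp: F8_def antichain_seqD[OF a] antichain_seqD[OF b] ab)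
  qed
  then show ?thesis by (simp add: has_obstruction_def)
qed

text \<open>The threshold of \<open>d i\<close> is the least \<open>j\<close> with \<open>d i \<preceq> c j\<close>: if infinitely many
  thresholds are missing, \<open>F1\<close> appears, if infinitely many are bounded, \<open>F4\<close> does, and otherwise
  a subsequence with strictly increasing thresholds gives \<open>F7\<close>.\<close>

lemma antichain_vs_omega:
  assumes d: "antichain_seq r (d :: nat \<Rightarrow> 'a)" and c: "ascending r (c :: nat \<Rightarrow> 'a)"
    and cd: "\<And>i j. \<not> c j \<preceq> d i"
  shows "has_obstruction A r"
proof (rule constant_subsequence[of "\<lambda>i. \<exists>j. d i \<preceq> c j"])
  fix \<phi> :: "nat \<Rightarrow> nat"
  assume "strict_mono \<phi>" and "\<forall>i. \<not> (\<exists>j. d (\<phi> i) \<preceq> c j)"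
  then show ?thesis
    using F1_I[OF antichain_seq_comp[OF d] c, of \<phi>] cd by (auto simp: strict_mono_imp_inj_on)
next
  fix \<phi> :: "nat \<Rightarrow> nat"
  assume \<phi>: "strict_mono \<phi>" "\<forall>i. \<exists>j. d (\<phi> i) \<preceq> c j"
  define t where "t i = (LEAST j. d (\<phi> i) \<preceq> c j)" for i
  have t: "d (\<phi> i) \<preceq> c j \<longleftrightarrow> t i \<le> j" for i j
  proof
    show "d (\<phi> i) \<preceq> c j \<Longrightarrow> t i \<le> j"
      unfolding t_def by (rule Least_le)
    have "d (\<phi> i) \<preceq> c (t i)"
      unfolding t_def using \<phi>(2) LeastI_ex[of "\<lambda>j. d (\<phi> i) \<preceq> c j"] by blast
    then show "t i \<le> j \<Longrightarrow> d (\<phi> i) \<preceq> c j"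
      using ascendingD[OF c] le_trans by blast
  qed
  have anti: "antichain_seq r (\<lambda>i. d (\<phi> (\<psi> i)))" if "strict_mono \<psi>" for \<psi> :: "nat \<Rightarrow> nat"
    using antichain_seq_comp[OF d, of "\<lambda>i. \<phi> (\<psi> i)"] \<phi>(1) that
    by (simp add: inj_on_def strict_mono_eq)
  show ?thesis
  proof (rule homogeneous_subsequence[of "\<lambda>i j. t i < t j"])
    fix \<psi> :: "nat \<Rightarrow> nat"
    assume \<psi>: "strict_mono \<psi>" "\<forall>i j. i < j \<longrightarrow> t (\<psi> i) < t (\<psi> j)"
    then have mono: "strict_mono (\<lambda>i. t (\<psi> i))"
      by (simp add: strict_mono_def)
    show ?thesis
      using F7_I[OF anti[OF \<psi>(1)] ascending_comp[OF c mono]] cd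
      by (simp add: t strict_mono_less_eq[OF mono])
  next
    fix \<psi> :: "nat \<Rightarrow> nat"
    assume \<psi>: "strict_mono \<psi>" "\<forall>i j. i < j \<longrightarrow> \<not> t (\<psi> i) < t (\<psi> j)"
    then have "t (\<psi> i) \<le> t (\<psi> 0) + k" for i k
      by (cases "i = 0") (auto simp: not_less trans_le_add1)
    then show ?thesis
      using F4_I[OF anti[OF \<psi>(1)] ascending_comp[OF c strict_mono_add_nat[of "t (\<psi> 0)"]]] cd
      by (simp add: t)
  qed
qed

end

section \<open>Orbits whose relations can only grow\<close>

definition shift_closed :: "'a rel \<Rightarrow> (int \<Rightarrow> 'a) \<Rightarrow> (int \<Rightarrow> 'a) \<Rightarrow> bool" where
  "shift_closed r x y \<longleftrightarrow> (\<forall>i j k. 0 \<le> k \<longrightarrow> (x i, y j) \<in> r \<longrightarrow> (x (i + k), y (j + k)) \<in> r)"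

lemma shift_closedD:
  "shift_closed r x y \<Longrightarrow> (x i, y j) \<in> r \<Longrightarrow> 0 \<le> k \<Longrightarrow> (x (i + k), y (j + k)) \<in> r"
  by (simp add: shift_closed_def)

lemma shift_closed_converse [simp]: "shift_closed (r\<inverse>) x y \<longleftrightarrow> shift_closed r y x"
  by (auto simp: shift_closed_def)

lemma shift_closed_scale:
  assumes "shift_closed r x y" and "0 \<le> d"
  shows "shift_closed r (\<lambda>n. x (i + d * n)) (\<lambda>n. y (j + d * n))"
proof (unfold shift_closed_def, intro allI impI)
  fix a b k :: int
  assume "0 \<le> k" and "(x (i + d * a), y (j + d * b)) \<in> r"
  then show "(x (i + d * (a + k)), y (j + d * (b + k))) \<in> r"
    using shift_closedD[OF assms(1), of "i + d * a" "j + d * b" "d * k"] assms(2)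
    by (simp add: algebra_simps)
qed

context poset
begin

text \<open>A comparability over a gap \<open>d\<close> is inherited by every later index, so its instances can be
  chained.\<close>

lemma orbit_step_chain:
  assumes sh: "shift_closed r z z" and zn: "z n \<preceq> z (n + d)" and "0 \<le> d" "n \<le> i"
  shows "z i \<preceq> z (i + d * int k)"
proof (induction k)
  case 0
  have "z i \<preceq> z (i + d)"
    using shift_closedD[OF sh zn, of "i - n"] \<open>n \<le> i\<close> by (simp add: algebra_simps)
  then show ?case
    by (simp add: le_reflL)
next
  case (Suc k)
  have "n \<le> i + d * int k"
    using assms(3,4) by (simp add: add_increasing2)
  then have "z (i + d * int k) \<preceq> z (i + d * int k + d)"
    using shift_closedD[OF sh zn, of "i + d * int k - n"] by (simp add: algebra_simps)
  with Suc show ?case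
    using le_trans by (simp add: algebra_simps)
qed

lemma orbit_ascending:
  assumes "shift_closed r z z" and "inj z" and "z n \<preceq> z (n + d)" and "0 < d" "n \<le> i"
  shows "ascending r (\<lambda>k :: nat. z (i + d * int k))"
  unfolding ascending_def
proof (intro allI iffI)
  have up: "z (i + d * int k) \<preceq> z (i + d * int l)" if "k \<le> l" for k l :: nat
  proof -
    have "n \<le> i + d * int k"
      using assms(4,5) by (simp add: add_increasing2)
    then show ?thesis
      using orbit_step_chain[OF assms(1,3), of "i + d * int k" "l - k"] assms(4) that
      by (simp add: algebra_simps of_nat_diff)
  qed
  then show "z (i + d * int k) \<preceq> z (i + d * int l)" if "k \<le> l" for k l :: nat
    using that .
  show "k \<le> l" if "z (i + d * int k) \<preceq> z (i + d * int l)" for k l :: nat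
  proof (rule ccontr)
    assume "\<not> k \<le> l"
    with up[of l k] that have "z (i + d * int k) = z (i + d * int l)"
      by (auto intro: le_antisym)
    with \<open>inj z\<close> \<open>0 < d\<close> have "k = l"
      by (simp add: inj_eq)
    with \<open>\<not> k \<le> l\<close> show False by simp
  qed
qed

text \<open>Two opposite comparabilities along one orbit, with gaps \<open>d\<close> and \<open>e\<close>, would both propagate
  to the common gap \<open>d * e\<close> and contradict antisymmetry.\<close>

lemma orbit_one_direction:
  assumes "shift_closed r z z" and "inj z" and "p < q" "z p \<preceq> z q" and "p' < q'"
  shows "\<not> z q' \<preceq> z p'"
proof
  assume opp: "z q' \<preceq> z p'"
  let ?n = "max p p'" and ?d = "q - p" and ?e = "q' - p'"
  have "z ?n \<preceq> z (?n + ?d * int (nat ?e))"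
    using assms by (intro orbit_step_chain[of _ p]) auto
  moreover have "z (?n + ?e * int (nat ?d)) \<preceq> z ?n"
    using poset.orbit_step_chain[OF dual, of z p' ?e ?n "nat ?d"] assms opp by simp
  ultimately have "z ?n = z (?n + ?d * ?e)"
    using assms(3,5) by (auto intro: le_antisym simp: mult.commute)
  with \<open>inj z\<close> assms(3,5) show False
    by (simp add: inj_eq)
qed

section \<open>One of the two orbits is finite\<close>

text \<open>A descending comparability of \<open>y\<close> cannot start at an index \<open>p \<le> 0\<close>: iterating it would place a
  late element of the orbit, and with it \<open>u\<close>, below \<open>y p\<close>. So such a comparability makes the past an
  antichain unrelated to a descending chain of the future. With only ascending comparabilities, the
  past contains either a descending \<open>\<omega>\<^sup>d\<close>-chain unrelated to \<open>u\<close>, which continues to an \<open>\<omega>\<close>-chain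
  above \<open>u\<close>, or an infinite antichain. If the orbit is an antichain, its future lies above \<open>u\<close> and
  its past is unrelated to \<open>u\<close>.\<close>

lemma fixed_point_case:
  assumes yA: "\<And>n. y n \<in> A" and sh: "shift_closed r y y" and inj: "inj y"
    and shu: "shift_closed r y (\<lambda>_. u)"
    and uy: "\<And>n. 1 \<le> n \<Longrightarrow> u \<preceq> y n" "\<And>n. n \<le> 0 \<Longrightarrow> \<not> u \<preceq> y n"
  shows "has_obstruction A r"
proof -
  interpret d: poset A "r\<inverse>" by (rule dual)
  have yu: "\<not> y n \<preceq> u" for n
  proof
    assume "y n \<preceq> u"
    then have "y (n + k) = u" if "1 \<le> n + k" "0 \<le> k" for k
      using shift_closedD[OF shu _ that(2)] uy(1)[OF that(1)] le_antisym by blast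
    from this[of "\<bar>n\<bar> + 1"] this[of "\<bar>n\<bar> + 2"] have "y (n + (\<bar>n\<bar> + 1)) = y (n + (\<bar>n\<bar> + 2))"
      by simp
    with inj show False
      by (simp add: inj_eq)
  qed
  consider (desc) p q where "p < q" "y q \<preceq> y p"
    | (asc) p q where "p < q" "y p \<preceq> y q" "\<And>p q. p < q \<Longrightarrow> \<not> y q \<preceq> y p"
    | (anti) "\<And>p q. p \<noteq> q \<Longrightarrow> \<not> y p \<preceq> y q"
    by (metis linorder_neqE)
  then show ?thesis
  proof cases
    case desc
    have up: "\<not> y p' \<preceq> y q'" if "p' < q'" for p' q'
      using d.orbit_one_direction[of y p q p' q'] sh inj desc that by simp
    have low: "\<not> y q' \<preceq> y p'" if "p' < q'" "p' \<le> 0" for p' q'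
    proof
      assume "y q' \<preceq> y p'"
      let ?m = "p' + (q' - p') * int (nat (1 - p'))"
      have "y ?m \<preceq> y p'"
        using d.orbit_step_chain[of y p' "q' - p'" p' "nat (1 - p')"] sh \<open>y q' \<preceq> y p'\<close> that by simp
      moreover have "1 \<le> ?m"
        using that mult_right_mono[of 1 "q' - p'" "int (nat (1 - p'))"] by linarith
      ultimately have "u \<preceq> y p'"
        using uy(1) le_trans by blast
      with uy(2) that show False by blast
    qed
    let ?n = "max 1 p"
    have "antichain_seq (r\<inverse>) (\<lambda>i. y (- int i))"
    proof -
      have "\<not> y (- int i) \<preceq> y (- int j)" if "i \<noteq> j" for i j
        using that up[of "- int i" "- int j"] low[of "- int j" "- int i"] by fastforce
      then show ?thesis
        using le_refl[OF yA] unfolding antichain_seq_def converse_iff by metis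
    qed
    moreover have "ascending (r\<inverse>) (\<lambda>k :: nat. y (?n + (q - p) * int k))"
      using d.orbit_ascending[of y p "q - p" ?n] sh inj desc by simp
    moreover have "- int i < ?n + (q - p) * int k" for i k
      using desc(1) by (smt (verit) mult_nonneg_nonneg of_nat_0_le_iff)
    ultimately show ?thesis
      using d.F1_I[of "\<lambda>i. y (- int i)" "\<lambda>k. y (?n + (q - p) * int k)"] up low by simp
  next
    case asc
    show ?thesis
    proof (rule homogeneous_subsequence[of "\<lambda>i j. y (- int j) \<preceq> y (- int i)"])
      fix \<phi> :: "nat \<Rightarrow> nat"
      assume \<phi>: "strict_mono \<phi>" "\<forall>i j. i < j \<longrightarrow> y (- int (\<phi> j)) \<preceq> y (- int (\<phi> i))"
      let ?a = "\<lambda>i. y (- int (\<phi> i))"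
      let ?d = "int (\<phi> 1) - int (\<phi> 0)" and ?p = "- int (\<phi> 1)"
      have d: "0 < ?d" and step: "y ?p \<preceq> y (?p + ?d)"
        using \<phi>(2) strict_monoD[OF \<phi>(1), of 0 1] by simp_all
      \<comment> \<open>Enough steps of size \<open>?d\<close> to carry the top of the past chain to a positive index.\<close>
      let ?m = "- int (\<phi> 0) + ?d * int (Suc (\<phi> 0))"
      have m: "1 \<le> ?m"
      proof -
        have "int (Suc (\<phi> 0)) \<le> ?d * int (Suc (\<phi> 0))"
          using d mult_right_mono[of 1 ?d "int (Suc (\<phi> 0))"] by force
        moreover have "1 \<le> - int n + w" if "int (Suc n) \<le> w" for n w
          using that by simp
        ultimately show ?thesis
          by blast
      qed
      have c: "ascending r (\<lambda>k :: nat. y (?m + ?d * int k))"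
        using orbit_ascending[OF sh inj step d, of ?m] m by simp
      have a0: "?a 0 \<preceq> y ?m"
        using d orbit_step_chain[OF sh step, of "- int (\<phi> 0)" "Suc (\<phi> 0)"] by simp
      have "?a j \<preceq> ?a i \<longleftrightarrow> i \<le> j" for i j
        using \<phi>(2) asc(3)[of "- int (\<phi> i)" "- int (\<phi> j)"] strict_mono_less[OF \<phi>(1), of j i]
          le_refl[OF yA] by (cases i j rule: linorder_cases) auto
      then have "ascending (r\<inverse>) ?a"
        by (simp add: ascending_def)
      then show ?thesis
        using F5_I[OF _ c, of ?a u] uy m yu a0 by simp
    next
      fix \<phi> :: "nat \<Rightarrow> nat"
      assume \<phi>: "strict_mono \<phi>" "\<forall>i j. i < j \<longrightarrow> \<not> y (- int (\<phi> j)) \<preceq> y (- int (\<phi> i))"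
      have "y (- int (\<phi> i)) \<preceq> y (- int (\<phi> j)) \<longleftrightarrow> i = j" for i j
        using \<phi>(2) asc(3)[of "- int (\<phi> j)" "- int (\<phi> i)"] strict_mono_less[OF \<phi>(1), of i j]
          le_refl[OF yA] by (cases i j rule: linorder_cases) auto
      then have "antichain_seq r (\<lambda>i. y (- int (\<phi> i)))"
        by (simp add: antichain_seq_def)
      moreover have "ascending r (\<lambda>k :: nat. y (max 1 p + (q - p) * int k))"
        using orbit_ascending[of y p "q - p" "max 1 p"] sh inj asc by simp
      moreover have "- int i < max 1 p + (q - p) * int k" for i k
        using asc(1) by (smt (verit) mult_nonneg_nonneg of_nat_0_le_iff)
      ultimately show ?thesis
        using antichain_vs_omega asc(3) by blast
    qed
  next
    case anti
    have "antichain_seq r y"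
      using anti le_refl[OF yA] by (auto simp: antichain_seq_def)
    then have "antichain_seq r (\<lambda>i. y (int i + 1))" "antichain_seq r (\<lambda>i. y (- int i))"
      by (simp_all add: antichain_seq_def)
    then show ?thesis
      using F2_I[of "\<lambda>i. y (int i + 1)" "\<lambda>i. y (- int i)" u] yu uy anti by simp
  qed
qed

section \<open>A relation gained within one orbit\<close>

text \<open>The future is an \<open>\<omega>\<close>-chain, so no later element of the orbit is ever below an earlier one. If the
  past has no infinite antichain, it contains a descending chain \<open>w\<close>, and some comparability
  \<open>w i \<preceq> w 0\<close> lets every \<open>z n\<close> climb into the future. An element \<open>z n\<close> above no \<open>w i\<close> is the
  isolated point of \<open>F5\<close>.\<close>

lemma orbit_step_case:
  assumes zA: "\<And>n. z n \<in> A" and sh: "shift_closed r z z" and inj: "inj z"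
    and low: "\<And>n. n \<le> 0 \<Longrightarrow> \<not> z n \<preceq> z (n + 1)" and up: "\<And>n. m \<le> n \<Longrightarrow> z n \<preceq> z (n + 1)"
  shows "has_obstruction A r"
proof -
  have no_down: "\<not> z q \<preceq> z p" if "p < q" for p q
    using orbit_one_direction[OF sh inj _ up[of m] that] by simp
  have c: "ascending r (\<lambda>k :: nat. z (K + int k))" if "m \<le> K" for K
    using orbit_ascending[OF sh inj up[of m], of K] that by simp
  show ?thesis
  proof (rule homogeneous_subsequence[of "\<lambda>i j. z (- int j) \<preceq> z (- int i)"])
    fix \<phi> :: "nat \<Rightarrow> nat"
    assume \<phi>: "strict_mono \<phi>" "\<forall>i j. i < j \<longrightarrow> \<not> z (- int (\<phi> j)) \<preceq> z (- int (\<phi> i))"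
    have "z (- int (\<phi> i)) \<preceq> z (- int (\<phi> j)) \<longleftrightarrow> i = j" for i j
      using \<phi>(2) no_down[of "- int (\<phi> j)" "- int (\<phi> i)"] strict_mono_less[OF \<phi>(1), of i j]
        le_refl[OF zA] by (cases i j rule: linorder_cases) auto
    then have "antichain_seq r (\<lambda>i. z (- int (\<phi> i)))"
      by (simp add: antichain_seq_def)
    then show ?thesis
      using antichain_vs_omega[OF _ c[of "max m 1"]] no_down by simp
  next
    fix \<phi> :: "nat \<Rightarrow> nat"
    assume \<phi>: "strict_mono \<phi>" "\<forall>i j. i < j \<longrightarrow> z (- int (\<phi> j)) \<preceq> z (- int (\<phi> i))"
    let ?w = "\<lambda>i. z (- int (\<phi> i))"
    have w: "?w j \<preceq> ?w i \<longleftrightarrow> i \<le> j" for i j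
      using \<phi>(2) no_down[of "- int (\<phi> i)" "- int (\<phi> j)"] strict_mono_less[OF \<phi>(1), of j i]
        le_refl[OF zA] by (cases i j rule: linorder_cases) auto
    have below: "- int (\<phi> (Suc (nat (- n)) + i)) < n" for n i
      using strict_mono_imp_increasing[OF \<phi>(1), of "Suc (nat (- n)) + i"] by linarith
    have reach: "\<exists>K\<ge>m. \<forall>K'\<ge>K. z n \<preceq> z K'" for n
    proof -
      let ?i = "Suc (nat (- n))"
      let ?p = "- int (\<phi> ?i)" and ?d = "int (\<phi> ?i) - int (\<phi> 0)"
      let ?K = "n + ?d * int (nat (m - n))"
      have "0 < ?d"
        using strict_monoD[OF \<phi>(1), of 0 ?i] by simp
      have "z ?p \<preceq> z (?p + ?d)"
        using \<phi>(2) by simp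
      then have "z n \<preceq> z ?K"
        using orbit_step_chain[OF sh, of ?p ?d n "nat (m - n)"] \<open>0 < ?d\<close> below[of n 0] by simp
      moreover have "m \<le> ?K"
        using mult_right_mono[of 1 ?d "int (nat (m - n))"] \<open>0 < ?d\<close> by linarith
      moreover have "z ?K \<preceq> z K'" if "?K \<le> K'" for K'
        using ascendingD[OF c[OF \<open>m \<le> ?K\<close>], of 0 "nat (K' - ?K)"] that by simp
      ultimately show ?thesis
        using le_trans by blast
    qed
    show ?thesis
    proof (cases "\<exists>n. \<forall>i. \<not> ?w i \<preceq> z n")
      case True
      then obtain n where n: "\<And>i. \<not> ?w i \<preceq> z n"
        by blast
      let ?s = "Suc (nat (- n))"
      obtain K L where K: "K \<ge> m" "\<forall>K'\<ge>K. z n \<preceq> z K'" and L: "\<forall>K'\<ge>L. ?w ?s \<preceq> z K'"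
        using reach[of n] reach[of "- int (\<phi> ?s)"] by blast
      have "ascending (r\<inverse>) (\<lambda>i. ?w (?s + i))"
        using w by (simp add: ascending_def)
      then show ?thesis
        using F5_I[OF _ c[of "max K L"], of _ "z n"] K L n no_down[OF below[of n]] by simp
    next
      case False
      have ev: "\<exists>N. \<forall>j\<ge>N. ?w j \<preceq> z n" for n
        using False w le_trans by meson
      \<comment> \<open>The rungs are \<open>z n\<close>, \<open>z (n + 1)\<close>. Lying below \<open>z (n - 1)\<close> as well makes, after one shift,
        both elements of the lower rung lie below both elements of the upper one.\<close>
      let ?Q = "\<lambda>i j. ?w j \<preceq> z (- int (\<phi> i) - 1) \<and> ?w j \<preceq> ?w i \<and>
        ?w j \<preceq> z (- int (\<phi> i) + 1)"
      have evQ: "\<exists>N. \<forall>j\<ge>N. ?Q i j" for i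
      proof -
        obtain N1 N2 N3 where "\<forall>j\<ge>N1. ?w j \<preceq> z (- int (\<phi> i) - 1)" "\<forall>j\<ge>N2. ?w j \<preceq> ?w i"
          "\<forall>j\<ge>N3. ?w j \<preceq> z (- int (\<phi> i) + 1)"
          using ev by meson
        then show ?thesis
          by (intro exI[of _ "max N1 (max N2 N3)"]) simp
      qed
      obtain \<psi> :: "nat \<Rightarrow> nat" where \<psi>: "strict_mono \<psi>"
        and desc: "\<forall>i j. i < j \<longrightarrow> ?Q (\<psi> i) (\<psi> j)"
        by (rule eventually_homogeneous_subsequence[of ?Q, OF evQ]) (rule that)
      let ?a = "\<lambda>i. ?w (\<psi> i)" and ?b = "\<lambda>i. z (- int (\<phi> (\<psi> i)) + 1)"
      obtain K L where K: "K \<ge> m" "\<forall>K'\<ge>K. ?a 0 \<preceq> z K'" and L: "\<forall>K'\<ge>L. ?b 0 \<preceq> z K'"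
        using reach by meson
      show ?thesis
      proof (rule F6_I[OF c[of "max K L"], of ?a ?b])
        show "?a j \<preceq> ?a i \<and> ?a j \<preceq> ?b i \<and> ?b j \<preceq> ?a i \<and> ?b j \<preceq> ?b i" if "i < j" for i j
          using desc that shift_closedD[OF sh, of _ _ 1] by (metis diff_add_cancel zero_le_one)
        show "\<not> ?a i \<preceq> ?b i" for i
          using low[of "- int (\<phi> (\<psi> i))"] by simp
      qed (use K L no_down in simp_all)
    qed
  qed
qed

text \<open>Restricting the orbit to \<open>i + (j - i) * n\<close> turns the gained relation into one between
  consecutive elements.\<close>

lemma orbit_relation_gained_forward:
  assumes zA: "\<And>n. z n \<in> A" and sh: "shift_closed r z z" and inj: "inj z"
    and "i < j" and old: "\<not> z i \<preceq> z j" and new: "z (i + k) \<preceq> z (j + k)" and "0 \<le> k"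
  shows "has_obstruction A r"
proof (rule orbit_step_case)
  let ?d = "j - i"
  let ?z = "\<lambda>n. z (i + ?d * n)"
  show "?z n \<in> A" for n
    by (rule zA)
  show "shift_closed r ?z ?z"
    using shift_closed_scale[OF sh] \<open>i < j\<close> by simp
  show "inj ?z"
    using inj \<open>i < j\<close> by (auto intro!: injI dest!: injD)
  show "\<not> ?z n \<preceq> ?z (n + 1)" if "n \<le> 0" for n
  proof
    assume "?z n \<preceq> ?z (n + 1)"
    moreover have "0 \<le> ?d * (- n)"
      using that \<open>i < j\<close> by (intro mult_nonneg_nonneg) auto
    ultimately show False
      using shift_closedD[OF sh, of "i + ?d * n" "i + ?d * (n + 1)" "?d * (- n)"] old
      by (simp add: algebra_simps)
  qed
  show "?z n \<preceq> ?z (n + 1)" if "k \<le> n" for n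
  proof -
    have "k \<le> ?d * n"
      using mult_right_mono[of 1 ?d n] \<open>i < j\<close> \<open>0 \<le> k\<close> that by simp
    then show ?thesis
      using shift_closedD[OF sh new, of "?d * n - k"] by (simp add: algebra_simps)
  qed
qed

lemma orbit_relation_gained:
  assumes zA: "\<And>n. z n \<in> A" and sh: "shift_closed r z z" and inj: "inj z"
    and old: "\<not> z i \<preceq> z j" and new: "z (i + k) \<preceq> z (j + k)" and "0 \<le> k"
  shows "has_obstruction A r"
proof (cases i j rule: linorder_cases)
  case less
  then show ?thesis
    using orbit_relation_gained_forward[of z i j k] assms by blast
next
  case equal
  with old zA le_refl show ?thesis by blast
next
  case greater
  then show ?thesis
    using poset.orbit_relation_gained_forward[OF dual, of z j i k] assms by simp
qed

end

section \<open>Orbits that gain no relation internally\<close>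

definition uniform_orbit :: "'a rel \<Rightarrow> (int \<Rightarrow> 'a) \<Rightarrow> bool" where
  "uniform_orbit r z \<longleftrightarrow> antichain_seq r z \<or> ascending r z \<or> ascending (r\<inverse>) z"

lemma uniform_orbit_multiples:
  assumes "uniform_orbit r z" and "0 < e"
  shows "uniform_orbit r (\<lambda>n. z (e * n))"
  using assms antichain_seq_comp[of _ z "\<lambda>n. e * n"] ascending_comp[of _ z "\<lambda>n. e * n"]
  by (auto simp: uniform_orbit_def inj_def strict_mono_def)

context poset
begin

text \<open>On a rigid orbit a relation depends only on the difference of the indices, so a comparability over
  the gap \<open>q - p\<close> holds everywhere, also arbitrarily far in the past.\<close>

lemma rigid_orbit_ascending:
  assumes sh: "shift_closed r z z" and inj: "inj z" and "p < q" "z p \<preceq> z q"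
    and rigid: "\<And>i j k. 0 \<le> k \<Longrightarrow> z (i + k) \<preceq> z (j + k) \<Longrightarrow> z i \<preceq> z j"
  shows "ascending r (\<lambda>n. z ((q - p) * n))"
  unfolding ascending_def
proof (intro allI iffI)
  let ?d = "q - p"
  have step: "z n \<preceq> z (n + ?d)" for n
  proof (rule rigid[of "\<bar>p - n\<bar>"])
    show "z (n + \<bar>p - n\<bar>) \<preceq> z (n + ?d + \<bar>p - n\<bar>)"
      using shift_closedD[OF sh assms(4), of "n + \<bar>p - n\<bar> - p"] by (simp add: algebra_simps)
  qed simp
  have up: "z (?d * i) \<preceq> z (?d * j)" if "i \<le> j" for i j
    using orbit_step_chain[OF sh step, of "?d * i" "?d * i" "nat (j - i)"] \<open>p < q\<close> that
    by (simp add: algebra_simps)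
  then show "z (?d * i) \<preceq> z (?d * j)" if "i \<le> j" for i j
    using that .
  show "i \<le> j" if "z (?d * i) \<preceq> z (?d * j)" for i j
  proof (rule ccontr)
    assume "\<not> i \<le> j"
    with up[of j i] that have "z (?d * i) = z (?d * j)"
      by (auto intro: le_antisym)
    with inj \<open>p < q\<close> \<open>\<not> i \<le> j\<close> show False
      by (simp add: inj_eq)
  qed
qed

lemma rigid_orbit_uniform:
  assumes zA: "\<And>n. z n \<in> A" and sh: "shift_closed r z z" and inj: "inj z"
    and rigid: "\<And>i j k. 0 \<le> k \<Longrightarrow> z (i + k) \<preceq> z (j + k) \<Longrightarrow> z i \<preceq> z j"
  shows "\<exists>d>0. uniform_orbit r (\<lambda>n. z (d * n))"
proof (cases "\<exists>p q. p \<noteq> q \<and> z p \<preceq> z q")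
  case True
  then obtain p q where pq: "p \<noteq> q" "z p \<preceq> z q"
    by blast
  then consider "p < q" | "q < p"
    by linarith
  then show ?thesis
  proof cases
    case 1
    with rigid_orbit_ascending[OF sh inj 1 pq(2) rigid] show ?thesis
      unfolding uniform_orbit_def by (intro exI[of _ "q - p"]) simp
  next
    case 2
    have "ascending (r\<inverse>) (\<lambda>n. z ((p - q) * n))"
      using poset.rigid_orbit_ascending[OF dual, of z q p] sh inj 2 pq(2) rigid by simp
    with 2 show ?thesis
      unfolding uniform_orbit_def by (intro exI[of _ "p - q"]) simp
  qed
next
  case False
  then have "antichain_seq r (\<lambda>n. z (1 * n))"
    using zA le_refl by (auto simp: antichain_seq_def)
  then show ?thesis
    unfolding uniform_orbit_def by (intro exI[of _ 1]) simp
qed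

end

section \<open>Two different infinite orbits\<close>

text \<open>Two disjoint orbits with the relations \<open>x n \<preceq> y n\<close> missing in the past and present in the future.
  The dual poset has the drifting pair \<open>y\<close>, \<open>x\<close>, which halves the case distinction.\<close>

locale drifting_pair = poset +
  fixes x y :: "int \<Rightarrow> 'a"
  assumes xA: "x n \<in> A" and yA: "y n \<in> A"
    and sh_xx: "shift_closed r x x" and sh_yy: "shift_closed r y y"
    and sh_xy: "shift_closed r x y" and sh_yx: "shift_closed r y x"
    and inj_x: "inj x" and inj_y: "inj y" and xy_distinct: "x i \<noteq> y j"
    and low: "n \<le> 0 \<Longrightarrow> \<not> x n \<preceq> y n" and up: "1 \<le> n \<Longrightarrow> x n \<preceq> y n"
begin

lemma dual_pair: "drifting_pair A (r\<inverse>) y x"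
proof -
  interpret d: poset A "r\<inverse>" by (rule dual)
  show ?thesis
    using xA yA sh_xx sh_yy sh_xy sh_yx inj_x inj_y xy_distinct low up
    by unfold_locales (auto simp: eq_commute)
qed

lemma pair_multiples:
  assumes "0 < d"
  shows "drifting_pair A r (\<lambda>n. x (d * n)) (\<lambda>n. y (d * n))"
proof unfold_locales
  show "inj (\<lambda>n. x (d * n))" "inj (\<lambda>n. y (d * n))"
    using inj_x inj_y assms by (auto intro!: injI dest!: injD)
  show "\<not> x (d * n) \<preceq> y (d * n)" if "n \<le> 0" for n
    using low[of "d * n"] assms that by (simp add: mult_nonneg_nonpos)
  show "x (d * n) \<preceq> y (d * n)" if "1 \<le> n" for n
    using up[of "d * n"] mult_mono[of 1 d 1 n] assms that by simp
qed (use xA yA xy_distinct assms shift_closed_scale[OF sh_xx, of d 0 0]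
    shift_closed_scale[OF sh_yy, of d 0 0] shift_closed_scale[OF sh_xy, of d 0 0]
    shift_closed_scale[OF sh_yx, of d 0 0] in simp_all)

lemma not_y_below_x: "\<not> y n \<preceq> x n"
proof
  assume "y n \<preceq> x n"
  then have "y (n + \<bar>1 - n\<bar>) \<preceq> x (n + \<bar>1 - n\<bar>)"
    using shift_closedD[OF sh_yx] by simp
  moreover have "x (n + \<bar>1 - n\<bar>) \<preceq> y (n + \<bar>1 - n\<bar>)"
    by (rule up) simp
  ultimately show False
    using le_antisym xy_distinct by metis
qed

text \<open>A relation \<open>y p \<preceq> x q\<close>, moved far into the future, would compare two elements of the antichain:
  \<open>x (p + k) \<preceq> y (p + k) \<preceq> x (q + k)\<close>.\<close>

lemma antichain_not_above_y:
  assumes "antichain_seq r x"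
  shows "\<not> y p \<preceq> x q"
proof
  assume yx: "y p \<preceq> x q"
  let ?k = "\<bar>p\<bar> + \<bar>q\<bar> + 1"
  have "x (p + ?k) \<preceq> y (p + ?k)"
    by (rule up) simp
  also have "y (p + ?k) \<preceq> x (q + ?k)"
    using shift_closedD[OF sh_yx yx] by simp
  finally (le_trans) have "p = q"
    using antichain_seqD[OF assms] by simp
  with yx not_y_below_x show False by simp
qed

text \<open>An integer chain contains an ascending \<open>\<omega>\<close>-chain whatever its direction, namely its future or its
  past.\<close>

lemma antichain_below_chain:
  assumes x: "antichain_seq r x" and y: "ascending r y \<or> ascending (r\<inverse>) y"
  shows "has_obstruction A r"
proof -
  have d: "antichain_seq r (\<lambda>i. x (int i))"
    using antichain_seq_comp[OF x, of int] by simp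
  have "ascending r (\<lambda>k. y (int k)) \<or> ascending r (\<lambda>k. y (- int k))"
    using y unfolding ascending_def converse_iff by (metis neg_le_iff_le of_nat_le_iff)
  then show ?thesis
    using antichain_vs_omega[OF d] antichain_not_above_y[OF x] by meson
qed

text \<open>If some \<open>y n\<close> with \<open>n \<le> 0\<close> lies above no \<open>x m\<close>, it is unrelated to the whole past of \<open>x\<close> before
  \<open>n\<close>, and both lie below the future of \<open>y\<close>: this is \<open>F5\<close>. The same holds with \<open>x\<close> and \<open>y\<close>
  exchanged. Otherwise sufficiently distant pairs \<open>x (- i)\<close>, \<open>y (- i)\<close> stack to the ladder.\<close>

lemma both_ascending:
  assumes x: "ascending r x" and y: "ascending r y"
  shows "has_obstruction A r"
proof -
  have xx: "x i \<preceq> x j \<longleftrightarrow> i \<le> j" and yy: "y i \<preceq> y j \<longleftrightarrow> i \<le> j" for i j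
    using ascendingD[OF x] ascendingD[OF y] by auto
  have c: "ascending r (\<lambda>k. y (1 + int k))" and xd: "ascending (r\<inverse>) (\<lambda>i. x (n - int i))"
    and yd: "ascending (r\<inverse>) (\<lambda>i. y (n - int i))" for n
    using x y by (auto simp: ascending_def)
  have top: "x n \<preceq> y 1" "y n \<preceq> y 1" if "n \<le> 0" for n
    using that xx[of n 1] yy[of n 1] up[of 1] le_trans by auto
  consider (x_low) n where "n \<le> 0" "\<And>m. \<not> x m \<preceq> y n"
    | (y_low) n where "n \<le> 0" "\<And>m. \<not> y m \<preceq> x n"
    | (ladder) "\<And>n. n \<le> 0 \<Longrightarrow> \<exists>m. x m \<preceq> y n" "\<And>n. n \<le> 0 \<Longrightarrow> \<exists>m. y m \<preceq> x n"
    by blast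
  then show ?thesis
  proof cases
    case x_low
    have "\<not> y n \<preceq> x (n - int i)" for i
      using not_y_below_x[of n] xx[of "n - int i" n] le_trans by auto
    with x_low top show ?thesis
      using F5_I[OF xd[of n] c, of "y n"] by simp
  next
    case y_low
    have "\<not> x n \<preceq> y (n - int i)" for i
      using low[of n] yy[of "n - int i" n] le_trans y_low(1) by auto
    with y_low top show ?thesis
      using F5_I[OF yd[of n] c, of "x n"] by simp
  next
    case ladder
    let ?Q = "\<lambda>i j. x (- int j) \<preceq> y (- int i) \<and> y (- int j) \<preceq> x (- int i)"
    have ev: "\<exists>N. \<forall>j\<ge>N. ?Q i j" for i
    proof -
      obtain m n where mn: "x m \<preceq> y (- int i)" "y n \<preceq> x (- int i)"
        using ladder[of "- int i"] by auto
      have "x (- int j) \<preceq> x m \<and> y (- int j) \<preceq> y n" if "nat (max (- m) (- n)) \<le> j" for j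
        using that xx[of "- int j" m] yy[of "- int j" n] by linarith
      then have "x (- int j) \<preceq> y (- int i) \<and> y (- int j) \<preceq> x (- int i)"
        if "nat (max (- m) (- n)) \<le> j" for j
        using that mn le_trans by blast
      then show ?thesis
        by blast
    qed
    obtain \<phi> :: "nat \<Rightarrow> nat" where \<phi>: "strict_mono \<phi>"
      and down: "\<forall>i j. i < j \<longrightarrow> ?Q (\<phi> i) (\<phi> j)"
      by (rule eventually_homogeneous_subsequence[of ?Q, OF ev]) (rule that)
    show ?thesis
      using F6_I[OF c, of "\<lambda>i. x (- int (\<phi> i))" "\<lambda>i. y (- int (\<phi> i))"]
        low not_y_below_x down top strict_mono_less[OF \<phi>] xx yy by (simp add: less_imp_le)
  qed
qed

text \<open>The set of indices \<open>j\<close> with \<open>x i \<preceq> y j\<close> is upward closed. If it is a proper nonempty subset of the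
  integers for some \<open>i\<close>, then \<open>x i\<close> together with the chain \<open>y\<close> is \<open>F5\<close>. Otherwise each \<open>x i\<close> is
  below all of \<open>y\<close> or below none of it, so a single \<open>y 0\<close> cuts the chain \<open>x\<close> and gives the dual of
  \<open>F5\<close>.\<close>

lemma descending_ascending:
  assumes x: "ascending (r\<inverse>) x" and y: "ascending r y"
  shows "has_obstruction A r"
proof -
  have xx: "x i \<preceq> x j \<longleftrightarrow> j \<le> i" and yy: "y i \<preceq> y j \<longleftrightarrow> i \<le> j" for i j
    using ascendingD[OF x, of j i] ascendingD[OF y] by auto
  have yx: "\<not> y m \<preceq> x n" for m n
  proof
    assume "y m \<preceq> x n"
    then have "y (min m n) \<preceq> x (min m n)"
      using xx[of n "min m n"] yy[of "min m n" m] le_trans by (meson min.cobounded1 min.cobounded2)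
    with not_y_below_x show False by blast
  qed
  show ?thesis
  proof (cases "\<exists>i j j'. \<not> x i \<preceq> y j \<and> x i \<preceq> y j'")
    case True
    then obtain i j j' where ij: "\<not> x i \<preceq> y j" "x i \<preceq> y j'"
      by blast
    then have below_j: "\<not> x i \<preceq> y (j - int k)" for k
      using yy[of "j - int k" j] le_trans by auto
    from ij have "j < j'"
      using yy[of j' j] le_trans by (meson not_less)
    moreover have "ascending (r\<inverse>) (\<lambda>k. y (j - int k))" "ascending r (\<lambda>k. y (j' + int k))"
      using y by (auto simp: ascending_def)
    ultimately show ?thesis
      using F5_I[of "\<lambda>k. y (j - int k)" "\<lambda>k. y (j' + int k)" "x i"] below_j ij yx yy by simp
  next
    case False
    interpret d: poset A "r\<inverse>" by (rule dual)
    have "x 1 \<preceq> y 0"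
      using False up[of 1] by auto
    moreover have "\<not> x (- int k) \<preceq> y 0" for k
      using False low[of "- int k"] by auto
    moreover have "ascending ((r\<inverse>)\<inverse>) (\<lambda>k. x (- int k))" "ascending (r\<inverse>) (\<lambda>k. x (1 + int k))"
      using x by (auto simp: ascending_def)
    ultimately show ?thesis
      using d.F5_I[of "\<lambda>k. x (- int k)" "\<lambda>k. x (1 + int k)" "y 0"] yx xx by simp
  qed
qed

lemma infinite_coinfinite_upset:
  assumes x: "antichain_seq r x" and y: "antichain_seq r y"
    and inf: "infinite {j. x i \<preceq> y j}" "infinite {j. \<not> x i \<preceq> y j}"
  shows "has_obstruction A r"
proof -
  obtain g h :: "nat \<Rightarrow> int" where g: "inj g" "range g \<subseteq> {j. x i \<preceq> y j}"
    and h: "inj h" "range h \<subseteq> {j. \<not> x i \<preceq> y j}"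
    using inf[THEN infinite_countable_subset] by blast
  have "g k \<noteq> h l" for k l
    using g(2) h(2) by (metis mem_Collect_eq range_subsetD)
  then have "\<not> y (g k) \<preceq> y (h l)" "\<not> y (h l) \<preceq> y (g k)" for k l
    using antichain_seqD[OF y] by metis+
  then show ?thesis
    using F2_I[OF antichain_seq_comp[OF y g(1)] antichain_seq_comp[OF y h(1)], of "x i"]
      g(2) h(2) antichain_not_above_y[OF x] by blast
qed

text \<open>If \<open>x i0\<close> is below almost all of \<open>y\<close>, then almost every difference \<open>l - i0\<close> of indices is
  realised by a relation at \<open>i0\<close>, hence at all later indices. A given \<open>y j\<close> therefore lies above
  \<open>x i\<close> for almost all \<open>i \<ge> i0\<close>. When every neighbourhood is finite or cofinite, this and the
  dual statement spread cofiniteness from one vertex of the bipartite graph to all of them.\<close>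

lemma cofinite_upset_imp_infinite_downset:
  assumes "finite {j. \<not> x i0 \<preceq> y j}"
  shows "infinite {i. x i \<preceq> y j}"
proof
  assume fin: "finite {i. x i \<preceq> y j}"
  have "{i0..} \<subseteq> {i. x i \<preceq> y j} \<union> (\<lambda>l. i0 + j - l) ` {j. \<not> x i0 \<preceq> y j}"
  proof
    fix i assume "i \<in> {i0..}"
    show "i \<in> {i. x i \<preceq> y j} \<union> (\<lambda>l. i0 + j - l) ` {j. \<not> x i0 \<preceq> y j}"
    proof (cases "x i0 \<preceq> y (i0 + j - i)")
      case True
      then have "x i \<preceq> y j"
        using shift_closedD[OF sh_xy True, of "i - i0"] \<open>i \<in> {i0..}\<close> by simp
      then show ?thesis by simp
    next
      case False
      then show ?thesis by (auto intro!: image_eqI[of _ _ "i0 + j - i"])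
    qed
  qed
  moreover have "infinite {i0..}"
    by (rule infinite_Ici)
  ultimately show False
    using fin assms by (meson finite_UnI finite_imageI finite_subset)
qed

end

text \<open>The pairs \<open>- n\<close>, \<open>1 + n\<close> join one index of the past to one of the future. Each one conflicts
  with finitely many others only, so infinitely many can be chosen without conflict.\<close>

lemma scattered_index_pairs:
  fixes R :: "int \<Rightarrow> int \<Rightarrow> bool"
  assumes "\<And>i. finite {j. \<not> R i j}" and "\<And>j. finite {i. \<not> R i j}"
  obtains \<phi> :: "nat \<Rightarrow> nat" where "strict_mono \<phi>"
    and "\<And>m n s t. m \<noteq> n \<Longrightarrow> s \<in> {- int (\<phi> m), 1 + int (\<phi> m)} \<Longrightarrow>
      t \<in> {- int (\<phi> n), 1 + int (\<phi> n)} \<Longrightarrow> R s t"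
proof -
  let ?p = "\<lambda>n. {- int n, 1 + int n}"
  let ?Q = "\<lambda>m n. \<forall>s\<in>?p m. \<forall>t\<in>?p n. R s t \<and> R t s"
  have ev: "\<exists>N. \<forall>n\<ge>N. ?Q m n" for m
  proof -
    let ?S = "\<Union>s\<in>?p m. {j. \<not> R s j} \<union> {i. \<not> R i s}"
    have "finite ?S"
      using assms by simp
    then obtain N1 N2 where N: "\<forall>n\<ge>N1. - int n \<notin> ?S" "\<forall>n\<ge>N2. 1 + int n \<notin> ?S"
      using finite_avoided_eventually[of ?S "\<lambda>n. - int n"]
        finite_avoided_eventually[of ?S "\<lambda>n. 1 + int n"] by (auto simp: inj_def)
    then have "\<forall>n\<ge>max N1 N2. ?Q m n"
      by auto
    then show ?thesis by blast
  qed
  obtain \<phi> :: "nat \<Rightarrow> nat" where \<phi>: "strict_mono \<phi>" "\<forall>i j. i < j \<longrightarrow> ?Q (\<phi> i) (\<phi> j)"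
    by (rule eventually_homogeneous_subsequence[of ?Q, OF ev]) (rule that)
  show thesis
    using \<phi> by (intro that[of \<phi>]) (metis linorder_neqE)+
qed

context drifting_pair
begin

lemma locally_finite_case:
  assumes x: "antichain_seq r x" and y: "antichain_seq r y"
    and fin: "\<And>i. finite {j. x i \<preceq> y j}" "\<And>j. finite {i. x i \<preceq> y j}"
  shows "has_obstruction A r"
proof -
  obtain \<phi> :: "nat \<Rightarrow> nat" where \<phi>: "strict_mono \<phi>"
    and scat: "\<And>m n s t. m \<noteq> n \<Longrightarrow> s \<in> {- int (\<phi> m), 1 + int (\<phi> m)} \<Longrightarrow>
      t \<in> {- int (\<phi> n), 1 + int (\<phi> n)} \<Longrightarrow> \<not> x s \<preceq> y t"
    using scattered_index_pairs[of "\<lambda>i j. \<not> x i \<preceq> y j"] fin by auto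
  have \<phi>_eq: "\<phi> i = \<phi> j \<longleftrightarrow> i = j" for i j
    using strict_mono_eq[OF \<phi>] .
  \<comment> \<open>Isolated points from even positions and two-element chains from odd ones: nothing is known about
    relations within a single index pair.\<close>
  let ?d = "\<lambda>i. x (- int (\<phi> (2 * i)))"
  let ?a = "\<lambda>i. x (1 + int (\<phi> (2 * i + 1)))" and ?b = "\<lambda>i. y (1 + int (\<phi> (2 * i + 1)))"
  show ?thesis
  proof (rule F3_I[of ?d ?a ?b])
    show "antichain_seq r ?d" "antichain_seq r ?a" "antichain_seq r ?b"
      using x y \<phi>_eq by (simp_all add: antichain_seq_def)
    show "\<not> ?d i \<preceq> ?a j" "\<not> ?a i \<preceq> ?d j" for i j
      using antichain_seqD[OF x] by simp_all
    show "\<not> ?d i \<preceq> ?b j" for i j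
      by (rule scat[of "2 * i" "2 * j + 1"]) (presburger, simp_all)
    show "?a i \<preceq> ?b j \<longleftrightarrow> i = j" for i j
      using scat[of "2 * i + 1" "2 * j + 1"] up by (cases "i = j") simp_all
  qed (rule antichain_not_above_y[OF x])+
qed

lemma locally_cofinite_case:
  assumes x: "antichain_seq r x" and y: "antichain_seq r y"
    and fin: "\<And>i. finite {j. \<not> x i \<preceq> y j}" "\<And>j. finite {i. \<not> x i \<preceq> y j}"
  shows "has_obstruction A r"
proof -
  obtain \<phi> :: "nat \<Rightarrow> nat" where \<phi>: "strict_mono \<phi>"
    and scat: "\<And>m n s t. m \<noteq> n \<Longrightarrow> s \<in> {- int (\<phi> m), 1 + int (\<phi> m)} \<Longrightarrow>
      t \<in> {- int (\<phi> n), 1 + int (\<phi> n)} \<Longrightarrow> x s \<preceq> y t"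
    using scattered_index_pairs[of "\<lambda>i j. x i \<preceq> y j"] fin by auto
  \<comment> \<open>Different integers must use different index pairs; the nonpositive ones take the past member of
    theirs, where \<open>x n \<preceq> y n\<close> fails, and the positive ones the future member, where it holds.\<close>
  define idx :: "int \<Rightarrow> nat" where "idx i = (if i \<le> 0 then 2 * nat (- i) else 2 * nat i + 1)" for i
  define h :: "int \<Rightarrow> int" where "h i = (if i \<le> 0 then - int (\<phi> (idx i)) else 1 + int (\<phi> (idx i)))" for i
  have idx: "idx i \<noteq> idx j" if "i \<noteq> j" for i j
    using that unfolding idx_def 
    by (auto simp: double_not_eq_Suc_double Suc_double_not_eq_double split: if_splits)
  have "inj h"
  proof (rule injI)
    fix i j assume "h i = h j"
    then have "idx i = idx j"
      using strict_mono_eq[OF \<phi>] by (auto simp: h_def split: if_splits)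
    with idx show "i = j" by blast
  qed
  then have anti: "antichain_seq r (\<lambda>i. x (h i))" "antichain_seq r (\<lambda>i. y (h i))"
    using x y by (simp_all add: antichain_seq_comp)
  have "x (h i) \<preceq> y (h j) \<longleftrightarrow> 0 < i \<or> j \<noteq> i" for i j
  proof (cases "i = j")
    case True
    then show ?thesis
      using low up by (simp add: h_def)
  next
    case False
    have "x (h i) \<preceq> y (h j)"
      by (rule scat[OF idx[OF False]]) (simp_all add: h_def)
    with False show ?thesis by simp
  qed
  then show ?thesis
    using F8_I[OF anti] antichain_not_above_y[OF x] by blast
qed

text \<open>Unless some vertex gives \<open>F2\<close> or its dual, every neighbourhood is finite or cofinite, and
  \<open>cofinite_upset_imp_infinite_downset\<close> with its dual shows that one of the two alternatives holds for
  all vertices at once.\<close>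

lemma both_antichains:
  assumes x: "antichain_seq r x" and y: "antichain_seq r y"
  shows "has_obstruction A r"
proof -
  interpret d: drifting_pair A "r\<inverse>" y x by (rule dual_pair)
  have up_dich: ?thesis if "infinite {j. x i \<preceq> y j}" "infinite {j. \<not> x i \<preceq> y j}" for i
    using infinite_coinfinite_upset[OF x y] that by blast
  have down_dich: ?thesis if "infinite {i. x i \<preceq> y j}" "infinite {i. \<not> x i \<preceq> y j}" for j
    using d.infinite_coinfinite_upset x y that by simp
  have cof_x: "infinite {i. x i \<preceq> y j}" if "finite {j. \<not> x i0 \<preceq> y j}" for i0 j
    using cofinite_upset_imp_infinite_downset that .
  have cof_y: "infinite {j. x i \<preceq> y j}" if "finite {i. \<not> x i \<preceq> y j0}" for i j0
    using d.cofinite_upset_imp_infinite_downset[of j0 i] that by simp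
  show ?thesis
  proof (cases "\<exists>i0. finite {j. \<not> x i0 \<preceq> y j}")
    case True
    then show ?thesis
      using locally_cofinite_case[OF x y] up_dich down_dich cof_x cof_y by blast
  next
    case False
    then show ?thesis
      using locally_finite_case[OF x y] up_dich down_dich cof_x cof_y by blast
  qed
qed

text \<open>The combination of ascending \<open>x\<close> and descending \<open>y\<close> is absurd: \<open>x 0 \<preceq> x 1 \<preceq> y 1 \<preceq> y 0\<close>.\<close>

lemma uniform_pair:
  assumes "uniform_orbit r x" and "uniform_orbit r y"
  shows "has_obstruction A r"
proof -
  interpret d: drifting_pair A "r\<inverse>" y x by (rule dual_pair)
  have "\<not> (ascending r x \<and> ascending (r\<inverse>) y)"
  proof
    assume "ascending r x \<and> ascending (r\<inverse>) y"
    then have "x 0 \<preceq> x 1" "y 1 \<preceq> y 0"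
      using ascendingD[of r x 0 1] ascendingD[of "r\<inverse>" y 0 1] by simp_all
    with up[of 1] low[of 0] show False
      using le_trans by (meson order_refl)
  qed
  then show ?thesis
    using assms antichain_below_chain both_ascending descending_ascending both_antichains
      d.antichain_below_chain d.both_ascending
    by (auto simp: uniform_orbit_def)
qed

lemma obstruction: "has_obstruction A r"
proof (rule ccontr)
  assume no: "\<not> has_obstruction A r"
  obtain d e where d: "0 < d" "uniform_orbit r (\<lambda>n. x (d * n))"
    and e: "0 < e" "uniform_orbit r (\<lambda>n. y (e * n))"
    using rigid_orbit_uniform[OF xA sh_xx inj_x] rigid_orbit_uniform[OF yA sh_yy inj_y]
      orbit_relation_gained[OF xA sh_xx inj_x] orbit_relation_gained[OF yA sh_yy inj_y] no
    by metis
  have "uniform_orbit r (\<lambda>n. x (d * e * n))" "uniform_orbit r (\<lambda>n. y (d * e * n))"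
    using uniform_orbit_multiples[OF d(2) e(1)] uniform_orbit_multiples[OF e(2) d(1)]
    by (simp_all add: mult.assoc mult.left_commute)
  then have "has_obstruction A r"
    using drifting_pair.uniform_pair[OF pair_multiples[of "d * e"]] d(1) e(1) by simp
  with no show False by blast
qed

end
section \<open>The orbits of a witness of irreversibility\<close>

text \<open>The bijection is controlled on the carrier only, so its inverse is taken relative to it.\<close>

definition two_sided_orbit :: "'a set \<Rightarrow> ('a \<Rightarrow> 'a) \<Rightarrow> 'a \<Rightarrow> int \<Rightarrow> 'a" where
  "two_sided_orbit A f a n =
    (if 0 \<le> n then (f ^^ nat n) a else (the_inv_into A f ^^ nat (- n)) a)"

context
  fixes A :: "'a set" and f :: "'a \<Rightarrow> 'a"
  assumes f: "bij_betw f A A"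
begin

lemma two_sided_orbit_carrier:
  assumes "a \<in> A"
  shows "two_sided_orbit A f a n \<in> A"
proof -
  have "(g ^^ k) a \<in> A" if "bij_betw g A A" for g k
    using bij_betw_apply[OF bij_betw_funpow[OF that] assms] .
  then show ?thesis
    using f bij_betw_the_inv_into[OF f] by (simp add: two_sided_orbit_def)
qed

lemma two_sided_orbit_step:
  assumes "a \<in> A"
  shows "two_sided_orbit A f a (n + 1) = f (two_sided_orbit A f a n)"
proof (cases "0 \<le> n")
  case True
  then show ?thesis
    by (simp add: two_sided_orbit_def nat_add_distrib)
next
  case False
  let ?g = "the_inv_into A f" and ?k = "nat (- (n + 1))"
  have k: "nat (- n) = Suc ?k"
    using False by simp
  have "(?g ^^ ?k) a \<in> A"
    using bij_betw_apply[OF bij_betw_funpow[OF bij_betw_the_inv_into[OF f]] assms] .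
  then have "f ((?g ^^ nat (- n)) a) = (?g ^^ ?k) a"
    unfolding k using f_the_inv_into_f_bij_betw[OF f] by simp
  then show ?thesis
    using False by (cases "n = -1") (simp_all add: two_sided_orbit_def)
qed

lemma two_sided_orbit_shift:
  assumes "a \<in> A" "b \<in> A" and f_mono: "\<And>u v. u \<in> A \<Longrightarrow> v \<in> A \<Longrightarrow> (u, v) \<in> r \<Longrightarrow> (f u, f v) \<in> r"
  shows "shift_closed r (two_sided_orbit A f a) (two_sided_orbit A f b)"
proof -
  let ?x = "two_sided_orbit A f a" and ?y = "two_sided_orbit A f b"
  have "(?x (i + int k), ?y (j + int k)) \<in> r" if "(?x i, ?y j) \<in> r" for i j k
  proof (induction k)
    case (Suc k)
    then have "(f (?x (i + int k)), f (?y (j + int k))) \<in> r"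
      using assms two_sided_orbit_carrier by blast
    then show ?case
      using two_sided_orbit_step assms by (simp add: ac_simps flip: two_sided_orbit_step)
  qed (use that in simp)
  then show ?thesis
    unfolding shift_closed_def by (metis zero_le_imp_eq_int)
qed

text \<open>Equality, unlike the order, also travels backwards, because \<open>f\<close> is injective.\<close>

lemma two_sided_orbit_eq_shift:
  assumes "a \<in> A" "b \<in> A" and eq: "two_sided_orbit A f a i = two_sided_orbit A f b j"
  shows "two_sided_orbit A f a (i + k) = two_sided_orbit A f b (j + k)"
proof -
  let ?x = "two_sided_orbit A f a" and ?y = "two_sided_orbit A f b"
  have step: "?x (m + 1) = ?y (n + 1) \<longleftrightarrow> ?x m = ?y n" for m n
    using two_sided_orbit_step two_sided_orbit_carrier assms(1,2)
      inj_on_eq_iff[OF bij_betw_imp_inj_on[OF f]] by simp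
  show ?thesis
  proof (induction k rule: int_induct[where k = 0])
    case (step1 k)
    then show ?case
      using step[of "i + k" "j + k"] by (simp add: add.assoc)
  next
    case (step2 k)
    then show ?case
      using step[of "i + (k - 1)" "j + (k - 1)"] by (simp add: algebra_simps)
  qed (use eq in simp)
qed

lemma two_sided_orbit_inj_or_periodic:
  assumes "a \<in> A"
  obtains "inj (two_sided_orbit A f a)"
  | d where "0 < d" "\<And>n. two_sided_orbit A f a (d * n) = a"
proof (cases "inj (two_sided_orbit A f a)")
  case False
  let ?x = "two_sided_orbit A f a"
  obtain i j where "i < j" "?x i = ?x j"
    using False unfolding inj_def by (metis linorder_neqE)
  then have period: "?x n = ?x (n + (j - i))" for n
    using two_sided_orbit_eq_shift[OF assms assms, of i j "n - i"] by (simp add: algebra_simps)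
  have "?x ((j - i) * n) = a" for n
  proof (induction n rule: int_induct[where k = 0])
    case base
    show ?case by (simp add: two_sided_orbit_def)
  next
    case (step1 k)
    then show ?case
      using period[of "(j - i) * k"] by (simp add: algebra_simps)
  next
    case (step2 k)
    then show ?case
      using period[of "(j - i) * (k - 1)"] by (simp add: algebra_simps)
  qed
  with \<open>i < j\<close> show thesis
    using that(2)[of "j - i"] by simp
qed (rule that(1))

end

theorem theorem1:
  fixes A :: "'a set" and r :: "'a rel"
  assumes "partial_order_on A r"
    and "\<not> reversible A r"
  shows "contains_copy A r F1 \<or> contains_copy A r (F1\<inverse>) \<or>
    contains_copy A r F2 \<or> contains_copy A r (F2\<inverse>) \<or>
    contains_copy A r F3 \<or> contains_copy A r (F3\<inverse>) \<or>
    contains_copy A r F4 \<or> contains_copy A r (F4\<inverse>) \<or>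
    contains_copy A r F5 \<or> contains_copy A r (F5\<inverse>) \<or>
    contains_copy A r F6 \<or> contains_copy A r (F6\<inverse>) \<or>
    contains_copy A r F7 \<or> contains_copy A r (F7\<inverse>) \<or>
    contains_copy A r F8 \<or> contains_copy A r (F8\<inverse>)"
proof -
  interpret poset A r
    using assms(1) by unfold_locales
  obtain f where f: "bij_betw f A A" and f_op: "order_preserving A r A r f"
    and not_iso: "\<not> order_isomorphism A r A r f"
    using assms(2) unfolding reversible_def by blast
  have f_mono: "f u \<preceq> f v" if "u \<in> A" "v \<in> A" "u \<preceq> v" for u v
    using f_op that by (simp add: order_preserving_def monotone_on_def)
  let ?g = "the_inv_into A f"
  have g: "bij_betw ?g A A"
    using f by (rule bij_betw_the_inv_into)
  have "\<not> order_preserving A r A r ?g"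
    using not_iso f f_op by (simp add: order_isomorphism_def)
  then obtain p q where "p \<in> A" "q \<in> A" "p \<preceq> q" "\<not> ?g p \<preceq> ?g q"
    using bij_betw_imp_surj_on[OF g] by (auto simp: order_preserving_def monotone_on_def)
  then obtain a b where ab: "a \<in> A" "b \<in> A" "\<not> a \<preceq> b" "f a \<preceq> f b"
    using bij_betw_apply[OF g] f_the_inv_into_f_bij_betw[OF f] by metis
  define x y where "x = two_sided_orbit A f a" and "y = two_sided_orbit A f b"
  have xA: "x n \<in> A" and yA: "y n \<in> A" for n
    unfolding x_def y_def by (rule two_sided_orbit_carrier[OF f ab(1)] two_sided_orbit_carrier[OF f ab(2)])+
  have sh: "shift_closed r x x" "shift_closed r y y" "shift_closed r x y" "shift_closed r y x"
    unfolding x_def y_def using two_sided_orbit_shift[OF f _ _ f_mono] ab(1,2) by blast+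
  have x0: "x 0 = a" "x 1 = f a" and y0: "y 0 = b" "y 1 = f b"
    by (simp_all add: x_def y_def two_sided_orbit_def)
  have low: "\<not> x n \<preceq> y n" if "n \<le> 0" for n
    using shift_closedD[OF sh(3), of n n "- n"] that ab(3) x0 y0 by auto
  have up: "x n \<preceq> y n" if "1 \<le> n" for n
    using shift_closedD[OF sh(3), of 1 1 "n - 1"] that ab(4) x0 y0 by simp
  have low': "\<not> x (d * n) \<preceq> y (d * n)" if "0 < d" "n \<le> 0" for d n
    using that by (intro low) (simp add: mult_nonneg_nonpos)
  have up': "x (d * n) \<preceq> y (d * n)" if "0 < d" "1 \<le> n" for d n
    using that mult_mono[of 1 d 1 n] by (intro up) simp
  have scale: "shift_closed r (\<lambda>n. u (d * n)) (\<lambda>n. v (d * n))"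
    if "shift_closed r u v" "0 < d" for u v :: "int \<Rightarrow> 'a" and d
    using shift_closed_scale[OF that(1), of d 0 0] that(2) by simp
  consider (finite) d e where "0 < d" "0 < e" "\<And>n. x (d * n) = a" "\<And>n. y (e * n) = b"
    | (x_finite) d where "0 < d" "\<And>n. x (d * n) = a" "inj y"
    | (y_finite) e where "0 < e" "\<And>n. y (e * n) = b" "inj x"
    | (infinite) "inj x" "inj y"
    using two_sided_orbit_inj_or_periodic[OF f ab(1)] two_sided_orbit_inj_or_periodic[OF f ab(2)]
    unfolding x_def y_def by metis
  then have "has_obstruction A r"
  proof cases
    case finite
    have "x (d * e) \<preceq> y (d * e)"
      using up'[of d e] finite(1,2) by simp
    also have "y (d * e) = b"
      using finite(4)[of d] by (simp add: mult.commute)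
    finally show ?thesis
      using finite(3)[of e] ab(3) by simp
  next
    case x_finite
    have "inj (\<lambda>n. y (d * n))"
      using x_finite(1,3) by (auto intro!: injI dest!: injD)
    then show ?thesis
      using fixed_point_case[of "\<lambda>n. y (d * n)" a] yA scale[OF sh(2) x_finite(1)]
        scale[OF sh(4) x_finite(1)] low'[OF x_finite(1)] up'[OF x_finite(1)] x_finite(2) by simp
  next
    case y_finite
    have "inj (\<lambda>n. x (e * n))"
      using y_finite(1,3) by (auto intro!: injI dest!: injD)
    then show ?thesis
      using poset.fixed_point_case[OF dual, of "\<lambda>n. x (e * n)" b] xA scale[OF sh(1) y_finite(1)]
        scale[OF sh(4) y_finite(1)] low'[OF y_finite(1)] up'[OF y_finite(1)] y_finite(2) by simp
  next
    case infinite
    show ?thesis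
    proof (cases "\<exists>i j. x i = y j")
      case True
      then obtain i j where ij: "x i = y j"
        by blast
      have y_x: "y n = x (n + (i - j))" for n
        using two_sided_orbit_eq_shift[OF f ab(1,2), of i j "n - j"] ij
        by (simp add: x_def y_def algebra_simps)
      show ?thesis
      proof (rule orbit_relation_gained[OF xA sh(1) infinite(1), of 0 "i - j" 1])
        show "\<not> x 0 \<preceq> x (i - j)"
          using low[of 0] y_x[of 0] by simp
        show "x (0 + 1) \<preceq> x (i - j + 1)"
          using up[of 1] y_x[of 1] by (simp add: algebra_simps)
      qed simp
    next
      case False
      then interpret drifting_pair A r x y
        using xA yA sh infinite low up by unfold_locales auto
      show ?thesis
        by (rule obstruction)
    qed
  qed
  then show ?thesis
    by (simp add: has_obstruction_def)
qed

end
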